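(* Let $(X_1,d_1)$ and $(X_2,d_2)$ be quasi-metric spaces and let $\varphi:X_1\to X_2$ be a bijection. Then $\varphi$ is an almost isometry if and only if there exists a function $f:X_2\to\mathbb{R}$ such that $$d_2(\varphi(x),\varphi(y))=d_1(x,y)+f(\varphi(y))-f(\varphi(x))$$ for every $x,y\in X_1$.
   Context: A quasi-metric on a set $X$ is a function $d:X\times X\to\mathbb{R}$ such that $d(x,y)\ge 0$ for all $x,y$, $d(x,y)=0$ if and only if $x=y$, and $d(x,y)+d(y,z)\ge d(x,z)$ for all $x,y,z$ (symmetry is not required). The triangular function of $(X,d)$ is $T(x,y,z)=d(x,y)+d(y,z)-d(x,z)$. A bijection $\varphi:X_1\to X_2$ between quasi-metric spaces with triangular functions $T_1,T_2$ is an almost isometry if $T_2(\varphi(x),\varphi(y),\varphi(z))=T_1(x,y,z)$ for all $x,y,z\in X_1$. *)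

theory Defs
  imports Complex_Main
begin

text \<open>All axioms are relative to the carrier \<open>M\<close>; values of \<open>d\<close> off \<open>M\<close> are unconstrained.\<close>

locale Quasi_metric_space =
  fixes M :: "'a set" and d :: "'a \<Rightarrow> 'a \<Rightarrow> real"
  assumes nonneg: "\<lbrakk>x \<in> M; y \<in> M\<rbrakk> \<Longrightarrow> 0 \<le> d x y"
    and zero: "\<lbrakk>x \<in> M; y \<in> M\<rbrakk> \<Longrightarrow> d x y = 0 \<longleftrightarrow> x = y"
    and triangle: "\<lbrakk>x \<in> M; y \<in> M; z \<in> M\<rbrakk> \<Longrightarrow> d x z \<le> d x y + d y z"

definition triangular_function :: "('a \<Rightarrow> 'a \<Rightarrow> real) \<Rightarrow> 'a \<Rightarrow> 'a \<Rightarrow> 'a \<Rightarrow> real" where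
  "triangular_function d x y z = d x y + d y z - d x z"

definition almost_isometry ::
  "'a set \<Rightarrow> ('a \<Rightarrow> 'a \<Rightarrow> real) \<Rightarrow> 'b set \<Rightarrow> ('b \<Rightarrow> 'b \<Rightarrow> real) \<Rightarrow> ('a \<Rightarrow> 'b) \<Rightarrow> bool" where
  "almost_isometry X1 d1 X2 d2 \<phi> \<longleftrightarrow>
     bij_betw \<phi> X1 X2 \<and>
     (\<forall>x\<in>X1. \<forall>y\<in>X1. \<forall>z\<in>X1.
        triangular_function d2 (\<phi> x) (\<phi> y) (\<phi> z) = triangular_function d1 x y z)"

end

theory Submission
  imports Defs
begin

text \<open>Put \<open>g x y = d2 (\<phi> x) (\<phi> y) - d1 x y\<close>. Preservation of the triangular function says
  exactly that \<open>g\<close> is an additive cocycle, \<open>g x y + g y z = g x z\<close>, and the formula with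
  \<open>f\<close> says exactly that \<open>g\<close> is a coboundary, \<open>g x y = f (\<phi> y) - f (\<phi> x)\<close>. Coboundaries
  are cocycles because the sum telescopes. Conversely, a cocycle is the coboundary of the
  function obtained from it by fixing its first argument at a base point \<open>a\<close>
  (\<open>additive_cocycle_iff_coboundary\<close>); as \<open>\<phi>\<close> is injective on \<open>X1\<close>, this function on
  \<open>X1\<close> can be transported to \<open>X2\<close>.\<close>

text \<open>The potential of a cocycle is \<open>g a\<close> for a base point \<open>a\<close>: the cocycle identity for
  \<open>a, x, y\<close> reads \<open>g x y = g a y - g a x\<close>.\<close>

lemma additive_cocycle_iff_coboundary:
  fixes g :: "'a \<Rightarrow> 'a \<Rightarrow> 'c::ab_group_add"
  shows "(\<forall>x\<in>X. \<forall>y\<in>X. \<forall>z\<in>X. g x y + g y z = g x z) \<longleftrightarrow>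
    (\<exists>h. \<forall>x\<in>X. \<forall>y\<in>X. g x y = h y - h x)"
proof
  assume cocycle: "\<forall>x\<in>X. \<forall>y\<in>X. \<forall>z\<in>X. g x y + g y z = g x z"
  show "\<exists>h. \<forall>x\<in>X. \<forall>y\<in>X. g x y = h y - h x"
  proof (cases "X = {}")
    case False
    then obtain a where "a \<in> X" by blast
    with cocycle have "\<forall>x\<in>X. \<forall>y\<in>X. g x y = g a y - g a x"
      by (metis add_diff_cancel_left')
    then show ?thesis by blast
  qed simp
next
  assume "\<exists>h. \<forall>x\<in>X. \<forall>y\<in>X. g x y = h y - h x"
  then show "\<forall>x\<in>X. \<forall>y\<in>X. \<forall>z\<in>X. g x y + g y z = g x z"
    by auto
qed

theorem proposition2p8:
  fixes X1 :: "'a set" and d1 :: "'a \<Rightarrow> 'a \<Rightarrow> real"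
    and X2 :: "'b set" and d2 :: "'b \<Rightarrow> 'b \<Rightarrow> real"
    and \<phi> :: "'a \<Rightarrow> 'b"
  assumes "Quasi_metric_space X1 d1"
    and "Quasi_metric_space X2 d2"
    and "bij_betw \<phi> X1 X2"
  shows "almost_isometry X1 d1 X2 d2 \<phi> \<longleftrightarrow>
    (\<exists>f :: 'b \<Rightarrow> real. \<forall>x\<in>X1. \<forall>y\<in>X1.
       d2 (\<phi> x) (\<phi> y) = d1 x y + f (\<phi> y) - f (\<phi> x))"
proof -
  define g where "g x y = d2 (\<phi> x) (\<phi> y) - d1 x y" for x y
  have "almost_isometry X1 d1 X2 d2 \<phi> \<longleftrightarrow>
      (\<forall>x\<in>X1. \<forall>y\<in>X1. \<forall>z\<in>X1. g x y + g y z = g x z)"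
    using assms(3) unfolding almost_isometry_def triangular_function_def g_def
    by (simp add: algebra_simps)
  also have "\<dots> \<longleftrightarrow> (\<exists>h. \<forall>x\<in>X1. \<forall>y\<in>X1. g x y = h y - h x)"
    by (rule additive_cocycle_iff_coboundary)
  also have "\<dots> \<longleftrightarrow> (\<exists>f. \<forall>x\<in>X1. \<forall>y\<in>X1. g x y = f (\<phi> y) - f (\<phi> x))"
  proof
    assume "\<exists>h. \<forall>x\<in>X1. \<forall>y\<in>X1. g x y = h y - h x"
    then obtain h where h: "\<forall>x\<in>X1. \<forall>y\<in>X1. g x y = h y - h x" ..
    have "\<forall>x\<in>X1. \<forall>y\<in>X1.
        g x y = (h \<circ> inv_into X1 \<phi>) (\<phi> y) - (h \<circ> inv_into X1 \<phi>) (\<phi> x)"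
      using h bij_betw_imp_inj_on[OF assms(3)] by simp
    then show "\<exists>f. \<forall>x\<in>X1. \<forall>y\<in>X1. g x y = f (\<phi> y) - f (\<phi> x)"
      by (rule exI[of _ "h \<circ> inv_into X1 \<phi>"])
  next
    assume "\<exists>f. \<forall>x\<in>X1. \<forall>y\<in>X1. g x y = f (\<phi> y) - f (\<phi> x)"
    then obtain f where "\<forall>x\<in>X1. \<forall>y\<in>X1. g x y = (f \<circ> \<phi>) y - (f \<circ> \<phi>) x" by auto
    then show "\<exists>h. \<forall>x\<in>X1. \<forall>y\<in>X1. g x y = h y - h x"
      by (rule exI[of _ "f \<circ> \<phi>"])
  qed
  also have "\<dots> \<longleftrightarrow> (\<exists>f. \<forall>x\<in>X1. \<forall>y\<in>X1.
       d2 (\<phi> x) (\<phi> y) = d1 x y + f (\<phi> y) - f (\<phi> x))"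
    unfolding g_def by (simp add: algebra_simps)
  finally show ?thesis .
qed

end
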